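(* Let $P:E\to B$ be a covering of finite categories and let $b$ be an object of $B$. Then $$\zeta_E(z)=\big(\zeta_B(z)\big)^{\# P^{-1}(b)}.$$
   Context: A finite category is a category with finitely many objects and finitely many morphisms. A small category $C$ is connected if for any objects $x,y$ of $C$ there is a finite zig-zag of morphisms $x\to x_1\leftarrow x_2\to\cdots\leftarrow y$ in $C$. For an object $x$ of $C$, $S(x)$ denotes the set of morphisms of $C$ with source $x$, and $T(x)$ the set of morphisms of $C$ with target $x$. Let $E$ and $B$ be small categories with $B$ connected. A functor $P:E\to B$ is a covering if for every object $x$ of $E$ the restrictions $P:S(x)\to S(P(x))$ and $P:T(x)\to T(P(x))$ are bijections. For an object $b$ of $B$, the fiber is $P^{-1}(b)=\{x\in \mathrm{Ob}(E)\mid P(x)=b\}$; its cardinality is called the number of sheets of $P$. For a small category $C$ and $n\ge 0$, $N_n(C)$ is the set of chains $x_0\xrightarrow{f_1}x_1\xrightarrow{f_2}\cdots\xrightarrow{f_n}x_n$ of $n$ composable morphisms in $C$ (identities allowed). The zeta function of a finite category $C$ is $$\zeta_C(z)=\exp\left(\sum_{n=1}^{\infty}\frac{\# N_n(C)}{n}z^n\right),$$ as a power series in $z$. *)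

theory Defs
  imports "HOL-Computational_Algebra.Formal_Power_Series"
begin

section \<open>Small categories\<close>

text \<open>Only the values of \<open>Dom\<close>, \<open>Cod\<close>, \<open>Id\<close> on the carriers, and of \<open>Comp\<close> on
  composable pairs, are constrained; \<open>Comp C g f\<close> is ``g after f''.\<close>

record ('o, 'm) cat =
  Obj :: "'o set"
  Mor :: "'m set"
  Dom :: "'m \<Rightarrow> 'o"
  Cod :: "'m \<Rightarrow> 'o"
  Id :: "'o \<Rightarrow> 'm"
  Comp :: "'m \<Rightarrow> 'm \<Rightarrow> 'm"

definition hom :: "('o, 'm) cat \<Rightarrow> 'o \<Rightarrow> 'o \<Rightarrow> 'm set" where
  "hom C x y = {f \<in> Mor C. Dom C f = x \<and> Cod C f = y}"

locale category =
  fixes C :: "('o, 'm) cat"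
  assumes Dom_in: "f \<in> Mor C \<Longrightarrow> Dom C f \<in> Obj C"
    and Cod_in: "f \<in> Mor C \<Longrightarrow> Cod C f \<in> Obj C"
    and Id_in: "x \<in> Obj C \<Longrightarrow> Id C x \<in> hom C x x"
    and Comp_in: "\<lbrakk>f \<in> hom C x y; g \<in> hom C y z\<rbrakk> \<Longrightarrow> Comp C g f \<in> hom C x z"
    and Comp_Id: "f \<in> hom C x y \<Longrightarrow> Comp C f (Id C x) = f"
    and Id_Comp: "f \<in> hom C x y \<Longrightarrow> Comp C (Id C y) f = f"
    and Comp_assoc: "\<lbrakk>f \<in> hom C w x; g \<in> hom C x y; h \<in> hom C y z\<rbrakk>
      \<Longrightarrow> Comp C h (Comp C g f) = Comp C (Comp C h g) f"

locale finite_category = category +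
  assumes finite_Obj: "finite (Obj C)"
    and finite_Mor: "finite (Mor C)"

text \<open>The objects \<open>z 0, \<dots>, z (2 * k)\<close> form the zig-zag
  \<open>x = z 0 \<rightarrow> z 1 \<leftarrow> z 2 \<rightarrow> \<dots> \<leftarrow> z (2 * k) = y\<close>.\<close>

locale connected_category = category +
  assumes zigzag: "\<lbrakk>x \<in> Obj C; y \<in> Obj C\<rbrakk> \<Longrightarrow>
    \<exists>(k::nat) z. z 0 = x \<and> z (2 * k) = y \<and>
      (\<forall>i<k. hom C (z (2 * i)) (z (2 * i + 1)) \<noteq> {} \<and>
             hom C (z (2 * i + 2)) (z (2 * i + 1)) \<noteq> {})"

definition source_star :: "('o, 'm) cat \<Rightarrow> 'o \<Rightarrow> 'm set" where
  "source_star C x = {f \<in> Mor C. Dom C f = x}"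

definition target_star :: "('o, 'm) cat \<Rightarrow> 'o \<Rightarrow> 'm set" where
  "target_star C x = {f \<in> Mor C. Cod C f = x}"


section \<open>Functors and coverings\<close>

text \<open>A functor is given by its object map \<open>Po\<close> and its morphism map \<open>Pm\<close>.\<close>

locale cat_functor = E: category E + B: category B
  for E :: "('a, 'f) cat" and B :: "('b, 'g) cat" +
  fixes Po :: "'a \<Rightarrow> 'b" and Pm :: "'f \<Rightarrow> 'g"
  assumes map_Obj: "x \<in> Obj E \<Longrightarrow> Po x \<in> Obj B"
    and map_hom: "f \<in> hom E x y \<Longrightarrow> Pm f \<in> hom B (Po x) (Po y)"
    and map_Id: "x \<in> Obj E \<Longrightarrow> Pm (Id E x) = Id B (Po x)"
    and map_Comp: "\<lbrakk>f \<in> hom E x y; g \<in> hom E y z\<rbrakk>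
      \<Longrightarrow> Pm (Comp E g f) = Comp B (Pm g) (Pm f)"

locale covering = cat_functor E B Po Pm + B: connected_category B
  for E :: "('a, 'f) cat" and B :: "('b, 'g) cat"
    and Po :: "'a \<Rightarrow> 'b" and Pm :: "'f \<Rightarrow> 'g" +
  assumes source_bij: "x \<in> Obj E \<Longrightarrow> bij_betw Pm (source_star E x) (source_star B (Po x))"
    and target_bij: "x \<in> Obj E \<Longrightarrow> bij_betw Pm (target_star E x) (target_star B (Po x))"

definition fiber :: "('a, 'f) cat \<Rightarrow> ('a \<Rightarrow> 'b) \<Rightarrow> 'b \<Rightarrow> 'a set" where
  "fiber E Po b = {x \<in> Obj E. Po x = b}"


section \<open>Chains and the zeta function\<close>

text \<open>A chain is recorded by its objects \<open>xs = [x\<^sub>0, \<dots>, x\<^sub>n]\<close> and its morphisms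
  \<open>fs = [f\<^sub>1, \<dots>, f\<^sub>n]\<close>; as lists are indexed from 0, \<open>fs ! i\<close> is a morphism
  from \<open>xs ! i\<close> to \<open>xs ! Suc i\<close>.\<close>

definition chains :: "('o, 'm) cat \<Rightarrow> nat \<Rightarrow> ('o list \<times> 'm list) set" where
  "chains C n = {(xs, fs). length xs = Suc n \<and> length fs = n \<and> set xs \<subseteq> Obj C \<and>
     (\<forall>i<n. fs ! i \<in> hom C (xs ! i) (xs ! Suc i))}"

text \<open>The exponential of a formal power series with zero constant term is its
  composition into the exponential series.\<close>

definition zeta :: "('o, 'm) cat \<Rightarrow> complex fps" where
  "zeta C = fps_exp 1 oo
     Abs_fps (\<lambda>n. if n = 0 then 0 else of_nat (card (chains C n)) / of_nat n)"

end

theory Submission imports Defs begin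

text \<open>A covering induces a bijection between the morphisms leaving \<open>x\<close> and those leaving
  \<open>Po x\<close>, so a chain of \<open>B\<close> starting at \<open>Po x\<close> lifts uniquely, morphism by morphism, to a
  chain of \<open>E\<close> starting at \<open>x\<close>. Sorting the chains of \<open>E\<close> by the image of their initial
  object shows that every chain of \<open>B\<close> starting at \<open>y\<close> has as many lifts as there are points
  in the fiber over \<open>y\<close>. Lifting a single morphism of \<open>B\<close> from either of its ends
  identifies the fibers over these ends; as \<open>B\<close> is connected, all fibers have the same
  cardinality \<open>k\<close> (\<open>card_fiber_eq\<close>). Hence \<open>E\<close> has \<open>k\<close> times as many \<open>n\<close>-chains as
  \<open>B\<close> for every \<open>n\<close> (\<open>card_chains_covering\<close>), and the exponential turns the factor \<open>k\<close>
  into the exponent of the zeta function (\<open>fps_exp_compose_of_nat_mult\<close>).\<close>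

definition chains_from :: "('o, 'm) cat \<Rightarrow> nat \<Rightarrow> 'o \<Rightarrow> ('o list \<times> 'm list) set" where
  "chains_from C n x = {c \<in> chains C n. hd (fst c) = x}"

context category
begin

lemma chains_from_0: "x \<in> Obj C \<Longrightarrow> chains_from C 0 x = {([x], [])}"
  by (auto simp: chains_from_def chains_def length_Suc_conv)

text \<open>Counting chains by their first morphism; this recursion lets the comparison of chains
  of \<open>E\<close> and \<open>B\<close> be made between stars only.\<close>

lemma bij_betw_chains_from_Suc:
  assumes "x \<in> Obj C"
  shows "bij_betw (\<lambda>(f, xs, fs). (x # xs, f # fs))
    (SIGMA f:source_star C x. chains_from C n (Cod C f)) (chains_from C (Suc n) x)"
proof (intro bij_betw_imageI subset_antisym subsetI)
  show "inj_on (\<lambda>(f, xs, fs). (x # xs, f # fs))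
      (SIGMA f:source_star C x. chains_from C n (Cod C f))"
    by (auto simp: inj_on_def)
next
  fix c assume "c \<in> (\<lambda>(f, xs, fs). (x # xs, f # fs)) `
      (SIGMA f:source_star C x. chains_from C n (Cod C f))"
  then obtain f xs fs where c: "c = (x # xs, f # fs)" and f: "f \<in> source_star C x"
    and xs: "(xs, fs) \<in> chains_from C n (Cod C f)"
    by auto
  then have "xs ! 0 = Cod C f"
    by (cases xs) (auto simp: chains_from_def chains_def)
  then have "(f # fs) ! i \<in> hom C ((x # xs) ! i) ((x # xs) ! Suc i)" if "i < Suc n" for i
    using that f xs
    by (cases i) (auto simp: chains_from_def chains_def source_star_def hom_def)
  then show "c \<in> chains_from C (Suc n) x"
    using c xs assms by (auto simp: chains_from_def chains_def)
next
  fix c assume c: "c \<in> chains_from C (Suc n) x"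
  then obtain xs f fs where c_eq: "c = (x # xs, f # fs)"
    unfolding chains_from_def chains_def by (cases c) (fastforce simp: length_Suc_conv)
  have step: "(f # fs) ! i \<in> hom C ((x # xs) ! i) ((x # xs) ! Suc i)" if "i < Suc n" for i
    using c that by (auto simp: c_eq chains_from_def chains_def)
  have f: "f \<in> hom C x (xs ! 0)"
    using step[of 0] by simp
  have "fs ! i \<in> hom C (xs ! i) (xs ! Suc i)" if "i < n" for i
    using step[of "Suc i"] that by simp
  moreover have "hd xs = Cod C f"
    using f c by (cases xs) (auto simp: c_eq hom_def chains_from_def chains_def)
  ultimately have "(xs, fs) \<in> chains_from C n (Cod C f)"
    using c by (auto simp: c_eq chains_from_def chains_def)
  moreover have "f \<in> source_star C x"
    using f by (auto simp: hom_def source_star_def)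
  ultimately show "c \<in> (\<lambda>(f, xs, fs). (x # xs, f # fs)) `
      (SIGMA f:source_star C x. chains_from C n (Cod C f))"
    by (force simp: c_eq)
qed

end

context finite_category
begin

lemma finite_source_star: "finite (source_star C x)"
  using finite_Mor by (simp add: source_star_def)

lemma finite_chains_from: "x \<in> Obj C \<Longrightarrow> finite (chains_from C n x)"
proof (induction n arbitrary: x)
  case 0
  then show ?case by (simp add: chains_from_0)
next
  case (Suc n)
  have "finite (SIGMA f:source_star C x. chains_from C n (Cod C f))"
    using Suc.IH finite_source_star Cod_in by (auto simp: source_star_def)
  then show ?case
    using bij_betw_finite[OF bij_betw_chains_from_Suc[OF Suc.prems]] by blast
qed

lemma card_chains_from_Suc:
  assumes "x \<in> Obj C"
  shows "card (chains_from C (Suc n) x) =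
    (\<Sum>f\<in>source_star C x. card (chains_from C n (Cod C f)))"
proof -
  have "\<forall>f\<in>source_star C x. finite (chains_from C n (Cod C f))"
    using finite_chains_from Cod_in by (auto simp: source_star_def)
  then show ?thesis
    using bij_betw_same_card[OF bij_betw_chains_from_Suc[OF assms, of n]]
    by (simp add: card_SigmaI finite_source_star)
qed

lemma card_chains: "card (chains C n) = (\<Sum>x\<in>Obj C. card (chains_from C n x))"
proof -
  have "hd xs \<in> Obj C" if "(xs, fs) \<in> chains C n" for xs fs
    using that by (cases xs) (auto simp: chains_def)
  then have "chains C n = (\<Union>x\<in>Obj C. chains_from C n x)"
    by (auto simp: chains_from_def)
  moreover have "card (\<Union>x\<in>Obj C. chains_from C n x) = (\<Sum>x\<in>Obj C. card (chains_from C n x))"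
    by (intro card_UN_disjoint ballI impI finite_chains_from)
      (auto simp: finite_Obj chains_from_def)
  ultimately show ?thesis by simp
qed

end

context covering
begin

lemma Dom_map: "g \<in> Mor E \<Longrightarrow> Dom B (Pm g) = Po (Dom E g)"
  using map_hom[of g "Dom E g" "Cod E g"] by (auto simp: hom_def)

lemma Cod_map: "g \<in> Mor E \<Longrightarrow> Cod B (Pm g) = Po (Cod E g)"
  using map_hom[of g "Dom E g" "Cod E g"] by (auto simp: hom_def)

text \<open>A lift of \<open>f\<close> is determined by its source, which may be any point over the source of
  \<open>f\<close>, and equally by its target.\<close>

lemma bij_betw_lifts_Dom:
  assumes f: "f \<in> Mor B"
  shows "bij_betw (Dom E) {g \<in> Mor E. Pm g = f} (fiber E Po (Dom B f))"
proof (intro bij_betw_imageI subset_antisym subsetI)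
  show "inj_on (Dom E) {g \<in> Mor E. Pm g = f}"
  proof (rule inj_onI)
    fix g h assume "g \<in> {g \<in> Mor E. Pm g = f}" "h \<in> {g \<in> Mor E. Pm g = f}" "Dom E g = Dom E h"
    then show "g = h"
      using bij_betw_imp_inj_on[OF source_bij[OF E.Dom_in, of g]]
      by (auto simp: source_star_def dest: inj_onD)
  qed
next
  fix x assume "x \<in> Dom E ` {g \<in> Mor E. Pm g = f}"
  then show "x \<in> fiber E Po (Dom B f)"
    using E.Dom_in Dom_map by (auto simp: fiber_def)
next
  fix x assume "x \<in> fiber E Po (Dom B f)"
  then have "x \<in> Obj E" "f \<in> source_star B (Po x)"
    using f by (auto simp: fiber_def source_star_def)
  then have "f \<in> Pm ` source_star E x"
    using bij_betw_imp_surj_on[OF source_bij] by blast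
  then show "x \<in> Dom E ` {g \<in> Mor E. Pm g = f}"
    by (auto simp: source_star_def)
qed

lemma bij_betw_lifts_Cod:
  assumes f: "f \<in> Mor B"
  shows "bij_betw (Cod E) {g \<in> Mor E. Pm g = f} (fiber E Po (Cod B f))"
proof (intro bij_betw_imageI subset_antisym subsetI)
  show "inj_on (Cod E) {g \<in> Mor E. Pm g = f}"
  proof (rule inj_onI)
    fix g h assume "g \<in> {g \<in> Mor E. Pm g = f}" "h \<in> {g \<in> Mor E. Pm g = f}" "Cod E g = Cod E h"
    then show "g = h"
      using bij_betw_imp_inj_on[OF target_bij[OF E.Cod_in, of g]]
      by (auto simp: target_star_def dest: inj_onD)
  qed
next
  fix x assume "x \<in> Cod E ` {g \<in> Mor E. Pm g = f}"
  then show "x \<in> fiber E Po (Cod B f)"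
    using E.Cod_in Cod_map by (auto simp: fiber_def)
next
  fix x assume "x \<in> fiber E Po (Cod B f)"
  then have "x \<in> Obj E" "f \<in> target_star B (Po x)"
    using f by (auto simp: fiber_def target_star_def)
  then have "f \<in> Pm ` target_star E x"
    using bij_betw_imp_surj_on[OF target_bij] by blast
  then show "x \<in> Cod E ` {g \<in> Mor E. Pm g = f}"
    by (auto simp: target_star_def)
qed

lemma card_fiber_hom:
  assumes "hom B x y \<noteq> {}"
  shows "card (fiber E Po x) = card (fiber E Po y)"
proof -
  obtain f where "f \<in> Mor B" "Dom B f = x" "Cod B f = y"
    using assms by (auto simp: hom_def)
  then show ?thesis
    using bij_betw_same_card[OF bij_betw_lifts_Dom] bij_betw_same_card[OF bij_betw_lifts_Cod]
    by metis
qed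

lemma card_fiber_eq:
  assumes "x \<in> Obj B" "y \<in> Obj B"
  shows "card (fiber E Po x) = card (fiber E Po y)"
proof -
  obtain k :: nat and z where z: "z 0 = x" "z (2 * k) = y"
    and hom: "\<And>i. i < k \<Longrightarrow> hom B (z (2 * i)) (z (2 * i + 1)) \<noteq> {} \<and>
      hom B (z (2 * i + 2)) (z (2 * i + 1)) \<noteq> {}"
    using B.zigzag[OF assms] by blast
  have "card (fiber E Po (z 0)) = card (fiber E Po (z (2 * i)))" if "i \<le> k" for i
    using that
  proof (induction i)
    case 0
    show ?case by simp
  next
    case (Suc i)
    then show ?case
      using card_fiber_hom[of "z (2 * i)" "z (2 * i + 1)"]
        card_fiber_hom[of "z (2 * i + 2)" "z (2 * i + 1)"] hom[of i]
      by simp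
  qed
  then show ?thesis using z by blast
qed

text \<open>Unique lifting of chains with prescribed initial object, in numerical form.\<close>

lemma card_chains_from_covering:
  assumes "finite_category E" "finite_category B" "x \<in> Obj E"
  shows "card (chains_from E n x) = card (chains_from B n (Po x))"
  using \<open>x \<in> Obj E\<close>
proof (induction n arbitrary: x)
  case 0
  then show ?case by (simp add: E.chains_from_0 B.chains_from_0 map_Obj)
next
  case (Suc n)
  have "card (chains_from E (Suc n) x) =
      (\<Sum>g\<in>source_star E x. card (chains_from E n (Cod E g)))"
    by (rule finite_category.card_chains_from_Suc) fact+
  also have "\<dots> = (\<Sum>g\<in>source_star E x. card (chains_from B n (Cod B (Pm g))))"
    by (intro sum.cong) (auto simp: source_star_def Cod_map E.Cod_in Suc.IH)
  also have "\<dots> = (\<Sum>f\<in>source_star B (Po x). card (chains_from B n (Cod B f)))"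
    using source_bij[OF Suc.prems] by (rule sum.reindex_bij_betw)
  also have "\<dots> = card (chains_from B (Suc n) (Po x))"
    using finite_category.card_chains_from_Suc[OF assms(2) map_Obj[OF Suc.prems]] by simp
  finally show ?case .
qed

lemma card_chains_covering:
  assumes "finite_category E" "finite_category B" "b \<in> Obj B"
  shows "card (chains E n) = card (fiber E Po b) * card (chains B n)"
proof -
  have "card (chains E n) = (\<Sum>x\<in>Obj E. card (chains_from B n (Po x)))"
    using finite_category.card_chains[OF assms(1)] card_chains_from_covering[OF assms(1,2)]
    by simp
  also have "\<dots> = (\<Sum>y\<in>Obj B. \<Sum>x\<in>fiber E Po y. card (chains_from B n (Po x)))"
    unfolding fiber_def using map_Obj assms(1,2)[THEN finite_category.finite_Obj]
    by (intro sum.group[symmetric]) auto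
  also have "\<dots> = (\<Sum>y\<in>Obj B. card (fiber E Po y) * card (chains_from B n y))"
    by (simp add: fiber_def)
  also have "\<dots> = (\<Sum>y\<in>Obj B. card (fiber E Po b) * card (chains_from B n y))"
    using card_fiber_eq[OF _ assms(3)] by simp
  also have "\<dots> = card (fiber E Po b) * card (chains B n)"
    by (simp add: finite_category.card_chains[OF assms(2)] sum_distrib_left)
  finally show ?thesis .
qed

end

text \<open>The law \<open>exp (k A) = (exp A)\<^sup>k\<close>: both sides are the composition of
  \<open>exp (k X) = (exp X)\<^sup>k\<close> with \<open>A\<close>, which is defined because \<open>A\<close> has no constant term.\<close>

lemma fps_exp_compose_of_nat_mult:
  fixes A :: "'a::field_char_0 fps"
  assumes "fps_nth A 0 = 0"
  shows "fps_exp 1 oo (of_nat k * A) = (fps_exp 1 oo A) ^ k"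
proof -
  have "of_nat k * A = (fps_const (of_nat k) * fps_X) oo A"
    using assms by (simp add: fps_compose_mult_distrib flip: fps_of_nat)
  then have "fps_exp 1 oo (of_nat k * A) = (fps_exp 1 oo (fps_const (of_nat k) * fps_X)) oo A"
    using assms by (simp add: fps_compose_assoc)
  also have "\<dots> = fps_exp 1 ^ k oo A"
    by (simp add: fps_exp_power_mult)
  also have "\<dots> = (fps_exp 1 oo A) ^ k"
    using assms by (simp add: fps_compose_power)
  finally show ?thesis .
qed

theorem mainTheorem2:
  fixes E :: "('a, 'f) cat" and B :: "('b, 'g) cat"
    and Po :: "'a \<Rightarrow> 'b" and Pm :: "'f \<Rightarrow> 'g" and b :: 'b
  assumes "finite_category E"
    and "finite_category B"
    and "covering E B Po Pm"
    and "b \<in> Obj B"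
  shows "zeta E = zeta B ^ card (fiber E Po b)"
proof -
  define L :: "nat \<Rightarrow> complex fps" where
    "L k = Abs_fps (\<lambda>n. if n = 0 then 0 else of_nat (k * card (chains B n)) / of_nat n)" for k
  have "zeta E = fps_exp 1 oo L (card (fiber E Po b))"
    by (simp only: zeta_def L_def covering.card_chains_covering[OF assms(3,1,2,4)])
  also have "L (card (fiber E Po b)) = of_nat (card (fiber E Po b)) * L 1"
    by (simp add: L_def fps_eq_iff flip: fps_of_nat)
  also have "fps_exp 1 oo \<dots> = (fps_exp 1 oo L 1) ^ card (fiber E Po b)"
    by (rule fps_exp_compose_of_nat_mult) (simp add: L_def)
  also have "fps_exp 1 oo L 1 = zeta B"
    by (simp only: zeta_def L_def mult_1)
  finally show ?thesis .
qed

end
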